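(* Consider the time-dependent balls and bins model with feedback exponent $\alpha=1$ (i.e. $P_n=\Theta_n$ for all $n$). Then, as $n\to\infty$, $\Theta_n$ converges almost surely to a random variable $\Theta$, and $\mathbb{P}(\mathcal{D})=0$, where $\mathcal{D}=\{\lim_{n\to\infty}\Theta_n\text{ exists and belongs to }\{0,1\}\}$.
   Context: The time-dependent balls and bins model with two bins: let $(\sigma_n)_{n\ge 1}$ be a sequence of positive integers, let $\tau_0$ and $T_0$ be integers with $0<T_0<\tau_0$, and let $\tau_n=\tau_0+\sum_{i=1}^n\sigma_i$. With feedback exponent $\alpha$, define for $n\ge 0$: $\Theta_n=T_n/\tau_n$, $P_n=\frac{\Theta_n^{\alpha}}{\Theta_n^{\alpha}+(1-\Theta_n)^{\alpha}}$, and $T_{n+1}=T_n+B_{n+1}$, where conditionally on $\mathcal{F}_n=\sigma(B_1,\dots,B_n)$ the random variable $B_{n+1}$ is Binomial with size $\sigma_{n+1}$ (number of trials) and success probability $P_n$. Thus $T_n$ is the number of balls in the first bin at time $n$ out of $\tau_n$ balls in total. The event $\mathcal{D}$ is called dominance. *)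

theory Defs
  imports "HOL-Probability.Probability"
begin

definition total_balls :: "nat \<Rightarrow> (nat \<Rightarrow> nat) \<Rightarrow> nat \<Rightarrow> nat" where
  "total_balls \<tau>0 \<sigma> n = \<tau>0 + (\<Sum>i=1..n. \<sigma> i)"

definition first_bin :: "nat \<Rightarrow> (nat \<Rightarrow> 'a \<Rightarrow> nat) \<Rightarrow> nat \<Rightarrow> 'a \<Rightarrow> nat" where
  "first_bin T0 B n \<omega> = T0 + (\<Sum>i=1..n. B i \<omega>)"

definition proportion ::
  "nat \<Rightarrow> (nat \<Rightarrow> nat) \<Rightarrow> nat \<Rightarrow> (nat \<Rightarrow> 'a \<Rightarrow> nat) \<Rightarrow> nat \<Rightarrow> 'a \<Rightarrow> real" where
  "proportion \<tau>0 \<sigma> T0 B n \<omega> = real (first_bin T0 B n \<omega>) / real (total_balls \<tau>0 \<sigma> n)"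

definition feedback :: "real \<Rightarrow> real \<Rightarrow> real" where
  "feedback \<alpha> \<theta> = \<theta> powr \<alpha> / (\<theta> powr \<alpha> + (1 - \<theta>) powr \<alpha>)"

definition history :: "'a measure \<Rightarrow> (nat \<Rightarrow> 'a \<Rightarrow> nat) \<Rightarrow> nat \<Rightarrow> 'a measure" where
  "history M B n = sigma (space M) {B i -` A \<inter> space M | i A. i \<in> {1..n}}"

text \<open>
  The assumption \<open>cond_binomial\<close> says that the conditional law of \<open>B (n + 1)\<close> given the
  sigma-algebra generated by \<open>B 1, \<dots>, B n\<close> is binomial. The value \<open>B 0\<close> plays no role.
  Nothing is assumed about the size of \<open>B i\<close> pointwise: the bound \<open>B i \<le> \<sigma> i\<close>, and
  hence that the proportion and the success probability lie in the unit interval (outside of which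
  \<^const>\<open>binomial_pmf\<close> is unspecified), holds almost surely as a consequence.
\<close>

locale balls_and_bins = prob_space M
  for M :: "'a measure"
    and \<alpha> :: real
    and \<sigma> :: "nat \<Rightarrow> nat"
    and \<tau>0 T0 :: nat
    and B :: "nat \<Rightarrow> 'a \<Rightarrow> nat" +
  assumes sigma_pos: "\<And>n. n \<ge> 1 \<Longrightarrow> 0 < \<sigma> n"
    and T0_pos: "0 < T0"
    and T0_less: "T0 < \<tau>0"
    and B_measurable: "\<And>n. n \<ge> 1 \<Longrightarrow> B n \<in> measurable M (count_space UNIV)"
    and cond_binomial: "\<And>n k. AE \<omega> in M.
      real_cond_exp M (history M B n) (indicator {\<omega> \<in> space M. B (Suc n) \<omega> = k}) \<omega>
        = pmf (binomial_pmf (\<sigma> (Suc n)) (feedback \<alpha> (proportion \<tau>0 \<sigma> T0 B n \<omega>))) k"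

definition dominance ::
  "'a measure \<Rightarrow> (nat \<Rightarrow> nat) \<Rightarrow> nat \<Rightarrow> nat \<Rightarrow> (nat \<Rightarrow> 'a \<Rightarrow> nat) \<Rightarrow> 'a set" where
  "dominance M \<sigma> \<tau>0 T0 B =
    {\<omega> \<in> space M. \<exists>l \<in> {0, 1}. (\<lambda>n. proportion \<tau>0 \<sigma> T0 B n \<omega>) \<longlonglongrightarrow> l}"

end

theory Submission
  imports Defs
begin

text \<open>
  For \<open>\<alpha> = 1\<close> the proportion is a martingale whose \<open>n\<close>-th conditional variance is at most
  \<open>\<sigma>\<^bsub>n+1\<^esub> / \<tau>\<^bsub>n+1\<^esub>\<^sup>2 \<le> 1 / \<tau>\<^bsub>n\<^esub> - 1 / \<tau>\<^bsub>n+1\<^esub>\<close>. Hence \<open>(\<Theta>\<^bsub>n\<^esub> - \<Theta>\<^bsub>m\<^esub>)\<^sup>2 + 1 / \<tau>\<^bsub>n\<^esub>\<close>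
  is, for \<open>n \<ge> m\<close>, a supermartingale with initial value \<open>1 / \<tau>\<^bsub>m\<^esub>\<close>, and the maximal inequality shows
  that the proportions are almost surely Cauchy.

  For dominance, the point is that for every \<open>C > 0\<close> the process \<open>(\<tau>\<^bsub>n\<^esub> / (\<tau>\<^bsub>n\<^esub> + C))\<close> to the power
  \<open>T\<^bsub>n\<^esub>\<close> is a supermartingale. It tends to \<open>1\<close> where \<open>\<Theta>\<^bsub>n\<^esub> \<longlonglongrightarrow> 0\<close>, so that event has
  probability at most \<open>(\<tau>\<^bsub>0\<^esub> / (\<tau>\<^bsub>0\<^esub> + C))\<close> to the power \<open>T\<^bsub>0\<^esub>\<close>, for every \<open>C\<close>; let
  \<open>C \<rightarrow> \<infinity>\<close>. The same argument applies to the other bin.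
\<close>

section \<open>Elementary inequalities and moments of the binomial law\<close>

text \<open>This is one supermartingale step for a bin holding \<open>U\<close> of \<open>t\<close>
  balls when a batch of \<open>m\<close> arrives. With \<open>x = t' / (t' + C)\<close>, the second
  factor is the binomial generating function at \<open>x\<close> with success probability
  \<open>U / t\<close>, because \<open>1 - x = C / (t' + C)\<close>. The discounts before and after
  the batch differ by the factor \<open>1 + m * u\<close>, so everything reduces to
  \<open>(1 - U * u) ^ m * (1 + m * u) ^ U \<le> 1\<close>.\<close>

lemma discounted_power_step:
  fixes t C :: real and U m :: nat
  assumes t: "0 < t" and C: "0 < C" and U: "real U \<le> t"
  defines "t' \<equiv> t + real m"
  shows "(t' / (t' + C)) ^ U * (1 - real U / t * (C / (t' + C))) ^ m \<le> (t / (t + C)) ^ U"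
proof -
  define u where "u = C / (t * (t' + C))"
  have t': "0 < t'" using t by (simp add: t'_def)
  have u: "0 < u" unfolding u_def using t t' C by simp
  have eq: "1 - real U / t * (C / (t' + C)) = 1 - real U * u"
    unfolding u_def using t by (simp add: field_simps)
  have "real U / t * (C / (t' + C)) \<le> 1 * 1"
    using t t' C U by (intro mult_mono) auto
  then have nn: "0 \<le> 1 - real U * u" using eq by simp
  have "(1 - real U * u) * (1 + u) ^ U \<le> exp (- (real U * u)) * exp u ^ U"
    using exp_ge_add_one_self[of "- (real U * u)"] exp_ge_add_one_self[of u] u
    by (intro mult_mono power_mono) auto
  also have "\<dots> = 1"
    by (simp add: exp_of_nat_mult[symmetric] exp_add[symmetric])
  finally have le_one: "(1 - real U * u) * (1 + u) ^ U \<le> 1" .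
  \<comment> \<open>Two elementary bounds suffice: \<open>1 - U u \<le> (1 + u)\<close> to the power \<open>- U\<close>, and Bernoulli's inequality.\<close>
  have "(1 - real U * u) ^ m * (1 + real m * u) ^ U \<le> (1 - real U * u) ^ m * ((1 + u) ^ m) ^ U"
    using nn u Bernoulli_inequality[of u m] by (intro mult_left_mono power_mono) auto
  also have "\<dots> = ((1 - real U * u) * (1 + u) ^ U) ^ m"
    by (simp add: power_mult_distrib power_mult[symmetric] mult.commute)
  also have "\<dots> \<le> 1" using le_one nn u by (intro power_le_one) auto
  finally have 2: "(1 - real U * u) ^ m * (1 + real m * u) ^ U \<le> 1" .
  have pos: "0 < 1 + real m * u" using u by (simp add: add_pos_nonneg)
  have 3: "t' / (t' + C) = t / (t + C) * (1 + real m * u)"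
    using t t' C unfolding u_def by (simp add: divide_simps) (simp add: t'_def algebra_simps)
  have "(t' / (t' + C)) ^ U * (1 - real U * u) ^ m
      = (t / (t + C)) ^ U * ((1 - real U * u) ^ m * (1 + real m * u) ^ U)"
    unfolding 3 power_mult_distrib by simp
  also have "\<dots> \<le> (t / (t + C)) ^ U * 1"
    using 2 t C by (intro mult_left_mono) auto
  finally show ?thesis unfolding eq by simp
qed

text \<open>The binomial generating function, arranged in the form that
  \<open>discounted_power_step\<close> expects; the companion below counts failures and serves the
  second bin.\<close>

lemma sum_Bernstein_power:
  "(\<Sum>k\<le>m. x ^ k * Bernstein m k p) = (1 - p * (1 - x)) ^ m"
proof -
  have "(\<Sum>k\<le>m. x ^ k * Bernstein m k p) = (p * x + (1 - p)) ^ m"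
    unfolding Bernstein_def binomial_ring
    by (intro sum.cong) (auto simp: power_mult_distrib)
  then show ?thesis by (simp add: algebra_simps)
qed

lemma sum_Bernstein_power_compl:
  "(\<Sum>k\<le>m. x ^ (m - k) * Bernstein m k p) = (1 - (1 - p) * (1 - x)) ^ m"
proof -
  have "(\<Sum>k\<le>m. x ^ (m - k) * Bernstein m k p) = (p + (1 - p) * x) ^ m"
    unfolding Bernstein_def binomial_ring
    by (intro sum.cong) (auto simp: power_mult_distrib)
  then show ?thesis by (simp add: algebra_simps)
qed

lemma sum_Bernstein_square:
  "(\<Sum>k\<le>m. (a + b * real k)\<^sup>2 * Bernstein m k p)
     = (a + b * (real m * p))\<^sup>2 + b\<^sup>2 * (real m * p * (1 - p))"
proof -
  \<comment> \<open>The square of \<open>k\<close> is split as \<open>k * (k - 1) + k\<close>, so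
    that the zeroth and the first two factorial moments of the Bernstein weights suffice.\<close>
  have "(a + b * real k)\<^sup>2 * Bernstein m k p = a\<^sup>2 * Bernstein m k p
      + (2 * a * b + b\<^sup>2) * (real k * Bernstein m k p)
      + b\<^sup>2 * (real k * (real k - 1) * Bernstein m k p)" for k
    by (simp add: power2_eq_square algebra_simps)
  then have "(\<Sum>k\<le>m. (a + b * real k)\<^sup>2 * Bernstein m k p)
    = a\<^sup>2 * (\<Sum>k\<le>m. Bernstein m k p) + (2 * a * b + b\<^sup>2) * (\<Sum>k\<le>m. real k * Bernstein m k p)
      + b\<^sup>2 * (\<Sum>k\<le>m. real k * (real k - 1) * Bernstein m k p)"
    by (simp only: sum.distrib sum_distrib_left)
  also have "\<dots> = (a + b * (real m * p))\<^sup>2 + b\<^sup>2 * (real m * p * (1 - p))"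
    unfolding sum_Bernstein sum_k_Bernstein sum_kk_Bernstein
    by (simp add: power2_eq_square algebra_simps)
  finally show ?thesis .
qed

text \<open>Both powers are nonnegative at every real base. The binomial mass formula is therefore
  available before the proportion is known to lie in the unit interval, which avoids circularity in
  \<open>AE_B_le\<close>.\<close>

lemma feedback_range: "feedback \<alpha> \<theta> \<in> {0..1}"
proof -
  have "0 \<le> a / (a + b) \<and> a / (a + b) \<le> 1" if "0 \<le> a" "0 \<le> b" for a b :: real
    using that by (cases "a + b = 0") (auto simp: divide_le_eq_1)
  then show ?thesis unfolding feedback_def by simp
qed

lemma feedback_one: "0 \<le> \<theta> \<Longrightarrow> \<theta> \<le> 1 \<Longrightarrow> feedback 1 \<theta> = \<theta>"
  unfolding feedback_def by simp

lemma measurable_tendsto_set: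
  fixes X :: "nat \<Rightarrow> 'a \<Rightarrow> real"
  assumes [measurable]: "\<And>n. X n \<in> borel_measurable M"
  shows "{\<omega> \<in> space M. (\<lambda>n. X n \<omega>) \<longlonglongrightarrow> c} \<in> sets M"
proof -
  \<comment> \<open>Both the Cauchy property and the value of \<open>lim\<close> are measurable in
    the sample point.\<close>
  have "(\<lambda>n. X n \<omega>) \<longlonglongrightarrow> c \<longleftrightarrow> Cauchy (\<lambda>n. X n \<omega>) \<and> lim (\<lambda>n. X n \<omega>) = c" for \<omega>
    by (metis Cauchy_convergent_iff convergent_LIMSEQ_iff limI convergentI)
  then show ?thesis by simp
qed

section \<open>A criterion for a proportion not to tend to zero\<close>

context prob_space
begin

lemma integrable_bounded_AE:
  fixes f :: "'a \<Rightarrow> real"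
  assumes "f \<in> borel_measurable M" "AE \<omega> in M. 0 \<le> f \<omega> \<and> f \<omega> \<le> c"
  shows "integrable M f"
proof (rule integrable_const_bound[where B = c])
  show "AE \<omega> in M. norm (f \<omega>) \<le> c"
    using assms(2) by eventually_elim simp
qed (rule assms(1))

lemma integrable_power_nat:
  fixes x :: real
  assumes [measurable]: "U \<in> measurable M (count_space UNIV)" and x: "0 \<le> x" "x \<le> 1"
  shows "integrable M (\<lambda>\<omega>. x ^ U \<omega>)"
proof (rule integrable_bounded_AE)
  show "AE \<omega> in M. 0 \<le> x ^ U \<omega> \<and> x ^ U \<omega> \<le> 1"
    using x by (intro AE_I2 conjI power_le_one) auto
qed measurable

text \<open>The discounted power is at least \<open>exp (- (C * (U n / t n)))\<close>, since
  \<open>1 + C / t n \<le> exp (C / t n)\<close>. This exponential depends on the proportion alone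
  and tends to 1 on the bad event, so dominated convergence turns the bound on expectations into a
  bound on the probability of that event, for every \<open>C\<close>.\<close>

lemma AE_not_tendsto_0:
  fixes U :: "nat \<Rightarrow> 'a \<Rightarrow> nat" and t :: "nat \<Rightarrow> real"
  assumes [measurable]: "\<And>n. U n \<in> measurable M (count_space UNIV)"
    and t: "\<And>n. 0 < t n" and t0: "0 < t0" and K: "0 < K"
    and le: "\<And>C n. 0 < C \<Longrightarrow> (\<integral>\<omega>. (t n / (t n + C)) ^ U n \<omega> \<partial>M) \<le> (t0 / (t0 + C)) ^ K"
  shows "AE \<omega> in M. \<not> (\<lambda>n. real (U n \<omega>) / t n) \<longlonglongrightarrow> 0"
proof -
  define D where "D = {\<omega> \<in> space M. (\<lambda>n. real (U n \<omega>) / t n) \<longlonglongrightarrow> 0}"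
  have D [measurable]: "D \<in> sets M"
    unfolding D_def by (rule measurable_tendsto_set) measurable
  have "prob D \<le> t0 / (t0 + C)" if C: "0 < C" for C :: real
  proof -
    let ?f = "\<lambda>n \<omega>. indicator D \<omega> * exp (- (C * (real (U n \<omega>) / t n)))"
    have nonneg: "0 \<le> C * (real (U n \<omega>) / t n)" for n \<omega>
      using C t[of n] by simp
    have "(\<lambda>n. \<integral>\<omega>. ?f n \<omega> \<partial>M) \<longlonglongrightarrow> (\<integral>\<omega>. indicator D \<omega> \<partial>M)"
    proof (rule integral_dominated_convergence[where w = "\<lambda>_. 1"])
      have "(\<lambda>n. ?f n \<omega>) \<longlonglongrightarrow> indicator D \<omega>" for \<omega>
      proof (cases "\<omega> \<in> D")
        case True
        then have "(\<lambda>n. exp (- (C * (real (U n \<omega>) / t n)))) \<longlonglongrightarrow> exp (- (C * 0))"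
          unfolding D_def by (intro tendsto_intros) auto
        then show ?thesis using True by simp
      qed simp
      then show "AE \<omega> in M. (\<lambda>n. ?f n \<omega>) \<longlonglongrightarrow> indicator D \<omega>" by simp
      show "AE \<omega> in M. norm (?f n \<omega>) \<le> 1" for n
        using nonneg by (auto simp: indicator_def)
    qed auto
    moreover have "(\<integral>\<omega>. ?f n \<omega> \<partial>M) \<le> t0 / (t0 + C)" for n
    proof -
      let ?x = "t n / (t n + C)"
      have x: "0 < ?x" "?x \<le> 1" using t[of n] C by auto
      have *: "?f n \<omega> \<le> ?x ^ U n \<omega>" for \<omega>
      proof -
        have "?f n \<omega> \<le> exp (- (C * (real (U n \<omega>) / t n)))"
          by (auto simp: indicator_def)
        also have "\<dots> = 1 / exp (C / t n) ^ U n \<omega>"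
          by (simp add: exp_of_nat_mult[symmetric] exp_minus field_simps)
        also have "\<dots> \<le> 1 / (1 + C / t n) ^ U n \<omega>"
          using C t[of n] by (intro divide_left_mono power_mono exp_ge_add_one_self mult_pos_pos zero_less_power)
            (auto simp: add_pos_pos)
        also have "\<dots> = ?x ^ U n \<omega>"
        proof -
          have "?x = 1 / (1 + C / t n)" using C t[of n] by (simp add: field_simps)
          then show ?thesis by (simp add: power_one_over)
        qed
        finally show ?thesis .
      qed
      have "(\<integral>\<omega>. ?f n \<omega> \<partial>M) \<le> (\<integral>\<omega>. ?x ^ U n \<omega> \<partial>M)"
      proof (rule integral_mono)
        show "integrable M (?f n)"
          using nonneg by (intro integrable_bounded_AE[where c = 1]) (auto simp: indicator_def)
        show "integrable M (\<lambda>\<omega>. ?x ^ U n \<omega>)"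
          using x by (intro integrable_power_nat) auto
      qed (rule *)
      also have "\<dots> \<le> (t0 / (t0 + C)) ^ K" by (rule le[OF C])
      \<comment> \<open>A single initial ball is enough: exponent 1 already makes the bound vanish
        as \<open>C\<close> tends to infinity.\<close>
      also have "\<dots> \<le> (t0 / (t0 + C)) ^ 1"
        using K t0 C by (intro power_decreasing) auto
      finally show ?thesis by simp
    qed
    ultimately have "(\<integral>\<omega>. indicator D \<omega> \<partial>M) \<le> t0 / (t0 + C)"
      by (intro LIMSEQ_le_const2) auto
    then show ?thesis using D by simp
  qed
  then have "eventually (\<lambda>C. prob D \<le> t0 / (t0 + C)) at_top"
    by (intro eventually_mono[OF eventually_gt_at_top[of 0]]) auto
  moreover have "((\<lambda>C. t0 / (t0 + C)) \<longlongrightarrow> 0) at_top"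
    by (intro tendsto_divide_0[OF tendsto_const] filterlim_at_top_imp_at_infinity
        filterlim_tendsto_add_at_top[OF tendsto_const] filterlim_ident)
  ultimately have "prob D \<le> 0"
    by (intro tendsto_lowerbound[of _ 0]) auto
  then have "prob D = 0" by (simp add: measure_le_0_iff)
  then have "AE \<omega> in M. \<omega> \<notin> D" using D by (simp add: prob_eq_0)
  then show ?thesis by (auto simp: D_def elim!: eventually_mono)
qed

end

section \<open>The model: ball counts, measurability and almost sure ranges\<close>

context balls_and_bins
begin

abbreviation \<tau> :: "nat \<Rightarrow> nat" where "\<tau> \<equiv> total_balls \<tau>0 \<sigma>"
abbreviation T :: "nat \<Rightarrow> 'a \<Rightarrow> nat" where "T \<equiv> first_bin T0 B"
abbreviation \<Theta> :: "nat \<Rightarrow> 'a \<Rightarrow> real" where "\<Theta> \<equiv> proportion \<tau>0 \<sigma> T0 B"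

lemma total_balls_Suc: "\<tau> (Suc n) = \<tau> n + \<sigma> (Suc n)"
  by (simp add: total_balls_def)

lemma first_bin_Suc: "T (Suc n) \<omega> = T n \<omega> + B (Suc n) \<omega>"
  by (simp add: first_bin_def)

lemma total_balls_ge: "\<tau>0 + n \<le> \<tau> n"
proof (induction n)
  case (Suc n)
  then show ?case using sigma_pos[of "Suc n"] by (simp add: total_balls_Suc)
qed (simp add: total_balls_def)

lemma total_balls_pos: "0 < \<tau> n"
  using total_balls_ge[of n] T0_less by simp

lemma filterlim_total_balls: "filterlim (\<lambda>n. real (\<tau> n)) at_top sequentially"
proof (rule filterlim_at_top_mono[OF filterlim_real_sequentially])
  show "\<forall>\<^sub>F n in sequentially. real n \<le> real (\<tau> n)"
    using total_balls_ge by (intro always_eventually) (metis add_leD2 of_nat_mono)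
qed

lemma space_history [simp]: "space (history M B n) = space M"
  unfolding history_def by (auto intro!: space_measure_of)

lemma B_measurable_history:
  assumes "i \<in> {1..n}"
  shows "B i \<in> measurable (history M B n) (count_space UNIV)"
proof (rule measurableI)
  fix A :: "nat set"
  have "{B i -` A \<inter> space M | i A. i \<in> {1..n}} \<subseteq> Pow (space M)" by auto
  then have "sets (history M B n) = sigma_sets (space M) {B i -` A \<inter> space M | i A. i \<in> {1..n}}"
    unfolding history_def by simp
  then show "B i -` A \<inter> space (history M B n) \<in> sets (history M B n)"
    using assms by (auto intro!: sigma_sets.Basic)
qed auto

lemma subalgebra_history: "subalgebra M (history M B n)"
proof -
  have *: "{B i -` A \<inter> space M | i A. i \<in> {1..n}} \<subseteq> sets M"
    using B_measurable by (auto intro!: measurable_sets[where A = "count_space UNIV"])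
  then have "sets (history M B n) = sigma_sets (space M) {B i -` A \<inter> space M | i A. i \<in> {1..n}}"
    unfolding history_def by (intro sets_measure_of) auto
  also have "\<dots> \<subseteq> sets M" using * by (rule sets.sigma_sets_subset)
  finally show ?thesis by (simp add: subalgebra_def)
qed

lemma measurable_from_history: "f \<in> measurable (history M B n) N \<Longrightarrow> f \<in> measurable M N"
  by (rule measurable_from_subalg[OF subalgebra_history])

lemma first_bin_measurable_history:
  assumes "m \<le> n"
  shows "T m \<in> measurable (history M B n) (count_space UNIV)"
proof -
  \<comment> \<open>On the naturals the Borel sets are all sets, so the closure of Borel functions
    under sums applies.\<close>
  have eq: "measurable (history M B n) (count_space UNIV :: nat measure) = borel_measurable (history M B n)"
    by (intro measurable_cong_sets refl sets_borel_eq_count_space[symmetric])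
  have "B i \<in> borel_measurable (history M B n)" if "i \<in> {1..m}" for i
    using B_measurable_history[of i n] that assms unfolding eq by auto
  then have "(\<lambda>\<omega>. T0 + (\<Sum>i=1..m. B i \<omega>)) \<in> borel_measurable (history M B n)"
    by (intro borel_measurable_add borel_measurable_sum) auto
  then show ?thesis unfolding eq first_bin_def[abs_def] .
qed

lemma first_bin_measurable [measurable]: "T n \<in> measurable M (count_space UNIV)"
  using measurable_from_history[OF first_bin_measurable_history[of n n]] by simp

lemma proportion_measurable_history:
  assumes "m \<le> n"
  shows "\<Theta> m \<in> borel_measurable (history M B n)"
  using first_bin_measurable_history[OF assms] unfolding proportion_def[abs_def] by measurable

lemma proportion_measurable [measurable]: "\<Theta> n \<in> borel_measurable M"
  using measurable_from_history[OF proportion_measurable_history[of n n]] by simp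

lemma B_Suc_measurable [measurable]: "B (Suc n) \<in> measurable M (count_space UNIV)"
  by (rule B_measurable) simp

text \<open>The binomial mass at each \<open>k\<close> above the number of trials is 0. Integrating
  the conditional probability shows that each such value is taken with probability 0, and there are
  countably many of them.\<close>

lemma AE_B_le: "AE \<omega> in M. B (Suc n) \<omega> \<le> \<sigma> (Suc n)"
proof -
  interpret F: finite_measure_subalgebra M "history M B n"
    by unfold_locales (rule subalgebra_history)
  have "AE \<omega> in M. B (Suc n) \<omega> \<noteq> k" if "k > \<sigma> (Suc n)" for k
  proof -
    let ?E = "{\<omega> \<in> space M. B (Suc n) \<omega> = k}"
    have E: "?E \<in> sets M" by measurable
    have int: "integrable M (indicator ?E :: 'a \<Rightarrow> real)"
      using E by (simp add: integrable_indicator_iff less_top[symmetric])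
    have "measure M ?E = (\<integral>\<omega>. indicator ?E \<omega> \<partial>M)" using E by simp
    also have "\<dots> = (\<integral>\<omega>. real_cond_exp M (history M B n) (indicator ?E) \<omega> \<partial>M)"
      using F.real_cond_exp_int(2)[OF int] by simp
    also have "\<dots> = (\<integral>\<omega>. 0 \<partial>M)"
    proof (rule integral_cong_AE)
      show "AE \<omega> in M. real_cond_exp M (history M B n) (indicator ?E) \<omega> = 0"
        using cond_binomial[of n k] that feedback_range by (auto simp: pmf_binomial)
    qed auto
    finally have "measure M ?E = 0" by simp
    then have "?E \<in> null_sets M" using E by (auto simp: null_sets_def emeasure_eq_measure)
    then show ?thesis by (rule AE_I') auto
  qed
  then have "AE \<omega> in M. \<forall>k. k > \<sigma> (Suc n) \<longrightarrow> B (Suc n) \<omega> \<noteq> k"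
    by (subst AE_all_countable) auto
  then show ?thesis by eventually_elim (auto simp: not_less)
qed

lemma AE_first_bin_le: "AE \<omega> in M. T n \<omega> \<le> \<tau> n"
proof (induction n)
  case 0
  then show ?case using T0_less by (simp add: first_bin_def total_balls_def)
next
  case (Suc n)
  from this AE_B_le[of n] show ?case
    by eventually_elim (simp add: first_bin_Suc total_balls_Suc)
qed

lemma AE_proportion_range: "AE \<omega> in M. 0 \<le> \<Theta> n \<omega> \<and> \<Theta> n \<omega> \<le> 1"
  using AE_first_bin_le[of n]
  by eventually_elim (use total_balls_pos[of n] in \<open>simp add: proportion_def\<close>)

end

section \<open>One-step expectations under linear feedback\<close>

locale linear_balls_and_bins = balls_and_bins M 1 \<sigma> \<tau>0 T0 B
  for M :: "'a measure" and \<sigma> \<tau>0 T0 B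
begin

text \<open>Bernstein weights are polynomials in the proportion, hence defined and measurable
  everywhere, and their sums have closed forms.\<close>

lemma AE_cond_Bernstein:
  assumes "k \<le> \<sigma> (Suc n)"
  shows "AE \<omega> in M. real_cond_exp M (history M B n) (indicator {\<omega> \<in> space M. B (Suc n) \<omega> = k}) \<omega>
    = Bernstein (\<sigma> (Suc n)) k (\<Theta> n \<omega>)"
  using cond_binomial[of n k] AE_proportion_range[of n]
  by eventually_elim (simp add: feedback_one Bernstein_def pmf_binomial)

text \<open>Split according to the value \<open>k\<close> of the new batch. On each slice
  \<open>g k\<close> depends on the history only, so it can be taken out of the conditional
  expectation of the slice's indicator, which is a Bernstein weight.\<close>

lemma
  fixes g :: "nat \<Rightarrow> 'a \<Rightarrow> real"
  assumes g: "\<And>k. g k \<in> borel_measurable (history M B n)" "\<And>k. integrable M (g k)"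
  shows integrable_step: "integrable M (\<lambda>\<omega>. \<Sum>k\<le>\<sigma> (Suc n). g k \<omega> * Bernstein (\<sigma> (Suc n)) k (\<Theta> n \<omega>))"
    and expectation_step: "(\<integral>\<omega>. g (B (Suc n) \<omega>) \<omega> \<partial>M)
      = (\<integral>\<omega>. (\<Sum>k\<le>\<sigma> (Suc n). g k \<omega> * Bernstein (\<sigma> (Suc n)) k (\<Theta> n \<omega>)) \<partial>M)"
    and integrable_updated: "integrable M (\<lambda>\<omega>. g (B (Suc n) \<omega>) \<omega>)"
proof -
  interpret F: finite_measure_subalgebra M "history M B n"
    by unfold_locales (rule subalgebra_history)
  let ?s = "\<sigma> (Suc n)"
  let ?E = "\<lambda>k. {\<omega> \<in> space M. B (Suc n) \<omega> = k}"
  have E [measurable]: "?E k \<in> sets M" for k by measurable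
  have gM [measurable]: "g k \<in> borel_measurable M" for k
    by (rule measurable_from_history[OF g(1)])
  have gB: "(\<lambda>\<omega>. g (B (Suc n) \<omega>) \<omega>) \<in> borel_measurable M"
    by (rule measurable_compose_countable[OF gM B_Suc_measurable])
  have int: "integrable M (\<lambda>\<omega>. g k \<omega> * indicator (?E k) \<omega>)" for k
    using E g(2) by (rule integrable_real_mult_indicator)
  have Bm: "(\<lambda>\<omega>. g k \<omega> * Bernstein ?s k (\<Theta> n \<omega>)) \<in> borel_measurable M" for k
    unfolding Bernstein_def by measurable
  have AE: "AE \<omega> in M. g k \<omega> * real_cond_exp M (history M B n) (indicator (?E k)) \<omega>
      = g k \<omega> * Bernstein ?s k (\<Theta> n \<omega>)" if "k \<le> ?s" for k
    using AE_cond_Bernstein[OF that] by eventually_elim simp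
  have ind: "indicator (?E k) \<in> borel_measurable M" for k
    by measurable
  have intB: "integrable M (\<lambda>\<omega>. g k \<omega> * Bernstein ?s k (\<Theta> n \<omega>))" if "k \<le> ?s" for k
    by (rule integrable_cong_AE_imp[OF F.real_cond_exp_intg(1)[OF int g(1) ind] Bm AE[OF that]])
  have eqB: "(\<integral>\<omega>. g k \<omega> * indicator (?E k) \<omega> \<partial>M) = (\<integral>\<omega>. g k \<omega> * Bernstein ?s k (\<Theta> n \<omega>) \<partial>M)"
    if "k \<le> ?s" for k
    unfolding F.real_cond_exp_intg(2)[OF int g(1) ind, symmetric]
    by (rule integral_cong_AE) (use Bm AE[OF that] in auto)
  \<comment> \<open>By \<open>AE_B_le\<close> the finitely many slices up to \<open>?s\<close> cover
    almost every sample point.\<close>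
  have split: "AE \<omega> in M. (\<Sum>k\<le>?s. g k \<omega> * indicator (?E k) \<omega>) = g (B (Suc n) \<omega>) \<omega>"
    using AE_B_le[of n] AE_space
  proof eventually_elim
    case (elim \<omega>)
    have "(\<Sum>k\<le>?s. g k \<omega> * indicator (?E k) \<omega>) = (\<Sum>k\<le>?s. if k = B (Suc n) \<omega> then g k \<omega> else 0)"
      using elim by (intro sum.cong) (auto simp: indicator_def)
    then show ?case using elim by simp
  qed
  show "integrable M (\<lambda>\<omega>. \<Sum>k\<le>?s. g k \<omega> * Bernstein ?s k (\<Theta> n \<omega>))"
    by (rule Bochner_Integration.integrable_sum) (use intB in auto)
  show "integrable M (\<lambda>\<omega>. g (B (Suc n) \<omega>) \<omega>)"
    by (rule integrable_cong_AE_imp[OF _ gB split]) (intro Bochner_Integration.integrable_sum int)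
  have "(\<integral>\<omega>. g (B (Suc n) \<omega>) \<omega> \<partial>M) = (\<integral>\<omega>. (\<Sum>k\<le>?s. g k \<omega> * indicator (?E k) \<omega>) \<partial>M)"
    by (rule integral_cong_AE) (use gB split in \<open>auto elim: eventually_mono\<close>)
  also have "\<dots> = (\<Sum>k\<le>?s. \<integral>\<omega>. g k \<omega> * indicator (?E k) \<omega> \<partial>M)"
    by (rule Bochner_Integration.integral_sum) (rule int)
  also have "\<dots> = (\<Sum>k\<le>?s. \<integral>\<omega>. g k \<omega> * Bernstein ?s k (\<Theta> n \<omega>) \<partial>M)"
    by (intro sum.cong eqB) auto
  also have "\<dots> = (\<integral>\<omega>. (\<Sum>k\<le>?s. g k \<omega> * Bernstein ?s k (\<Theta> n \<omega>)) \<partial>M)"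
    by (rule Bochner_Integration.integral_sum[symmetric]) (use intB in auto)
  finally show "(\<integral>\<omega>. g (B (Suc n) \<omega>) \<omega> \<partial>M)
      = (\<integral>\<omega>. (\<Sum>k\<le>?s. g k \<omega> * Bernstein ?s k (\<Theta> n \<omega>)) \<partial>M)" .
qed

text \<open>The form in which supermartingale steps are used: \<open>u\<close> is the old value of
  the process and \<open>v\<close> the new one. An almost sure upper bound \<open>g\<close> for
  \<open>v\<close> leaves room for truncated subtraction in the second bin and for freezing in the
  maximal inequality.\<close>

lemma expectation_step_le:
  fixes g :: "nat \<Rightarrow> 'a \<Rightarrow> real"
  assumes g: "\<And>k. g k \<in> borel_measurable (history M B n)" "\<And>k. integrable M (g k)"
    and uv: "integrable M u" "integrable M v"
    and v: "AE \<omega> in M. v \<omega> \<le> g (B (Suc n) \<omega>) \<omega>"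
    and u: "AE \<omega> in M. (\<Sum>k\<le>\<sigma> (Suc n). g k \<omega> * Bernstein (\<sigma> (Suc n)) k (\<Theta> n \<omega>)) \<le> u \<omega>"
  shows "(\<integral>\<omega>. v \<omega> \<partial>M) \<le> (\<integral>\<omega>. u \<omega> \<partial>M)"
proof -
  have "(\<integral>\<omega>. v \<omega> \<partial>M) \<le> (\<integral>\<omega>. g (B (Suc n) \<omega>) \<omega> \<partial>M)"
    by (rule integral_mono_AE[OF uv(2) integrable_updated[where g = g, OF g] v])
  also have "\<dots> \<le> (\<integral>\<omega>. u \<omega> \<partial>M)"
    unfolding expectation_step[where g = g, OF g]
    by (rule integral_mono_AE[OF integrable_step[where g = g, OF g] uv(1) u])
  finally show ?thesis .
qed

section \<open>Dominance has probability zero\<close>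

lemma discounted_expectation_first_bin:
  fixes C :: real
  assumes C: "0 < C"
  shows "(\<integral>\<omega>. (\<tau> n / (\<tau> n + C)) ^ T n \<omega> \<partial>M) \<le> (\<tau>0 / (\<tau>0 + C)) ^ T0"
proof (induction n)
  case 0
  show ?case by (simp add: total_balls_def first_bin_def prob_space)
next
  case (Suc n)
  let ?x = "\<lambda>n. real (\<tau> n) / (real (\<tau> n) + C)"
  have x: "0 < ?x n" "?x n \<le> 1" for n using total_balls_pos[of n] C by auto
  have [measurable]: "T n \<in> measurable (history M B n) (count_space UNIV)"
    by (rule first_bin_measurable_history) simp
  have int: "integrable M (\<lambda>\<omega>. ?x i ^ U \<omega>)" if "U \<in> measurable M (count_space UNIV)" for i U
    using x[of i] that by (intro integrable_power_nat) auto
  have "(\<integral>\<omega>. ?x (Suc n) ^ T (Suc n) \<omega> \<partial>M) \<le> (\<integral>\<omega>. ?x n ^ T n \<omega> \<partial>M)"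
  proof (rule expectation_step_le[where g = "\<lambda>k \<omega>. ?x (Suc n) ^ (T n \<omega> + k)"])
    show "AE \<omega> in M. (\<Sum>k\<le>\<sigma> (Suc n). ?x (Suc n) ^ (T n \<omega> + k) * Bernstein (\<sigma> (Suc n)) k (\<Theta> n \<omega>))
        \<le> ?x n ^ T n \<omega>"
      using AE_first_bin_le[of n]
    proof eventually_elim
      case (elim \<omega>)
      have "(\<Sum>k\<le>\<sigma> (Suc n). ?x (Suc n) ^ (T n \<omega> + k) * Bernstein (\<sigma> (Suc n)) k (\<Theta> n \<omega>))
          = ?x (Suc n) ^ T n \<omega> * (1 - \<Theta> n \<omega> * (1 - ?x (Suc n))) ^ \<sigma> (Suc n)"
        unfolding sum_Bernstein_power[symmetric] by (simp only: power_add sum_distrib_left mult.assoc)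
      also have "1 - ?x (Suc n) = C / (real (\<tau> (Suc n)) + C)"
        using total_balls_pos[of "Suc n"] C by (simp add: field_simps)
      also have "?x (Suc n) ^ T n \<omega> * (1 - \<Theta> n \<omega> * (C / (real (\<tau> (Suc n)) + C))) ^ \<sigma> (Suc n)
          \<le> ?x n ^ T n \<omega>"
        using discounted_power_step[of "\<tau> n" C "T n \<omega>" "\<sigma> (Suc n)"] total_balls_pos[of n] C elim
        by (simp add: total_balls_Suc proportion_def)
      finally show ?case .
    qed
    show "AE \<omega> in M. ?x (Suc n) ^ T (Suc n) \<omega> \<le> ?x (Suc n) ^ (T n \<omega> + B (Suc n) \<omega>)"
      by (simp add: first_bin_Suc)
  qed (measurable, (rule int, measurable)+)
  then show ?case using Suc by simp
qed

lemma discounted_expectation_second_bin: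
  fixes C :: real
  assumes C: "0 < C"
  shows "(\<integral>\<omega>. (\<tau> n / (\<tau> n + C)) ^ (\<tau> n - T n \<omega>) \<partial>M) \<le> (\<tau>0 / (\<tau>0 + C)) ^ (\<tau>0 - T0)"
proof (induction n)
  case 0
  show ?case by (simp add: total_balls_def first_bin_def prob_space)
next
  case (Suc n)
  let ?x = "\<lambda>n. real (\<tau> n) / (real (\<tau> n) + C)"
  have x: "0 < ?x n" "?x n \<le> 1" for n using total_balls_pos[of n] C by auto
  have [measurable]: "T n \<in> measurable (history M B n) (count_space UNIV)"
    by (rule first_bin_measurable_history) simp
  have int: "integrable M (\<lambda>\<omega>. ?x i ^ U \<omega>)" if "U \<in> measurable M (count_space UNIV)" for i U
    using x[of i] that by (intro integrable_power_nat) auto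
  have "(\<integral>\<omega>. ?x (Suc n) ^ (\<tau> (Suc n) - T (Suc n) \<omega>) \<partial>M) \<le> (\<integral>\<omega>. ?x n ^ (\<tau> n - T n \<omega>) \<partial>M)"
  \<comment> \<open>The second bin gains \<open>\<sigma> (Suc n) - k\<close> balls. Keeping the two
    truncated differences apart lets the Bernstein sum factor; their sum is the new count wherever
    \<open>T n \<le> \<tau> n\<close> and \<open>B (Suc n) \<le> \<sigma> (Suc n)\<close>, hence
    almost surely.\<close>
  proof (rule expectation_step_le[where g = "\<lambda>k \<omega>. ?x (Suc n) ^ ((\<tau> n - T n \<omega>) + (\<sigma> (Suc n) - k))"])
    show "AE \<omega> in M. ?x (Suc n) ^ (\<tau> (Suc n) - T (Suc n) \<omega>)
        \<le> ?x (Suc n) ^ ((\<tau> n - T n \<omega>) + (\<sigma> (Suc n) - B (Suc n) \<omega>))"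
      using AE_first_bin_le[of n] AE_B_le[of n]
      by eventually_elim (simp add: first_bin_Suc total_balls_Suc)
    show "AE \<omega> in M. (\<Sum>k\<le>\<sigma> (Suc n). ?x (Suc n) ^ ((\<tau> n - T n \<omega>) + (\<sigma> (Suc n) - k))
          * Bernstein (\<sigma> (Suc n)) k (\<Theta> n \<omega>)) \<le> ?x n ^ (\<tau> n - T n \<omega>)"
      using AE_first_bin_le[of n]
    proof eventually_elim
      case (elim \<omega>)
      have "(\<Sum>k\<le>\<sigma> (Suc n). ?x (Suc n) ^ ((\<tau> n - T n \<omega>) + (\<sigma> (Suc n) - k)) * Bernstein (\<sigma> (Suc n)) k (\<Theta> n \<omega>))
          = ?x (Suc n) ^ (\<tau> n - T n \<omega>) * (1 - (1 - \<Theta> n \<omega>) * (1 - ?x (Suc n))) ^ \<sigma> (Suc n)"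
        unfolding sum_Bernstein_power_compl[symmetric] by (simp only: power_add sum_distrib_left mult.assoc)
      also have "1 - ?x (Suc n) = C / (real (\<tau> (Suc n)) + C)"
        using total_balls_pos[of "Suc n"] C by (simp add: field_simps)
      also have "1 - \<Theta> n \<omega> = real (\<tau> n - T n \<omega>) / real (\<tau> n)"
        using total_balls_pos[of n] elim by (simp add: proportion_def of_nat_diff field_simps)
      also have "?x (Suc n) ^ (\<tau> n - T n \<omega>)
            * (1 - real (\<tau> n - T n \<omega>) / real (\<tau> n) * (C / (real (\<tau> (Suc n)) + C))) ^ \<sigma> (Suc n)
          \<le> ?x n ^ (\<tau> n - T n \<omega>)"
        using discounted_power_step[of "\<tau> n" C "\<tau> n - T n \<omega>" "\<sigma> (Suc n)"] total_balls_pos[of n] C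
        by (simp add: total_balls_Suc)
      finally show ?case .
    qed
  qed (measurable, (rule int, measurable)+)
  then show ?case using Suc by simp
qed

lemma AE_not_dominance: "AE \<omega> in M. \<omega> \<notin> dominance M \<sigma> \<tau>0 T0 B"
proof -
  have 0: "AE \<omega> in M. \<not> (\<lambda>n. real (T n \<omega>) / real (\<tau> n)) \<longlonglongrightarrow> 0"
    by (rule AE_not_tendsto_0[OF _ _ _ T0_pos discounted_expectation_first_bin])
      (use total_balls_pos T0_less in auto)
  have 1: "AE \<omega> in M. \<not> (\<lambda>n. real (\<tau> n - T n \<omega>) / real (\<tau> n)) \<longlonglongrightarrow> 0"
    by (rule AE_not_tendsto_0[OF _ _ _ _ discounted_expectation_second_bin])
      (use total_balls_pos T0_less in auto)
  have "AE \<omega> in M. \<forall>n. T n \<omega> \<le> \<tau> n"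
    unfolding AE_all_countable using AE_first_bin_le by blast
  from this 0 1 show ?thesis
  proof eventually_elim
    case (elim \<omega>)
    have eq: "real (\<tau> n - T n \<omega>) / real (\<tau> n) = 1 - \<Theta> n \<omega>" for n
      using elim(1) total_balls_pos[of n] by (simp add: proportion_def of_nat_diff diff_divide_distrib)
    \<comment> \<open>A proportion tending to 1 in the first bin is one tending to 0 in the
      second.\<close>
    have "\<not> (\<lambda>n. \<Theta> n \<omega>) \<longlonglongrightarrow> 1"
    proof
      assume "(\<lambda>n. \<Theta> n \<omega>) \<longlonglongrightarrow> 1"
      then have "(\<lambda>n. 1 - \<Theta> n \<omega>) \<longlonglongrightarrow> 1 - 1" by (intro tendsto_intros)
      then show False using elim(3) unfolding eq by simp
    qed
    then show ?case using elim(2) by (auto simp: dominance_def proportion_def)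
  qed
qed

lemma dominance_measurable: "dominance M \<sigma> \<tau>0 T0 B \<in> sets M"
proof -
  have "dominance M \<sigma> \<tau>0 T0 B
      = {\<omega> \<in> space M. (\<lambda>n. \<Theta> n \<omega>) \<longlonglongrightarrow> 0} \<union> {\<omega> \<in> space M. (\<lambda>n. \<Theta> n \<omega>) \<longlonglongrightarrow> 1}"
    by (auto simp: dominance_def)
  then show ?thesis by (simp add: measurable_tendsto_set)
qed

section \<open>Maximal inequality and almost sure convergence\<close>

lemma prob_deviation_le:
  assumes \<epsilon>: "0 < \<epsilon>" and "m \<le> n"
  shows "prob {\<omega> \<in> space M. \<exists>j\<in>{m..n}. \<epsilon> \<le> \<bar>\<Theta> j \<omega> - \<Theta> m \<omega>\<bar>} \<le> 1 / (\<epsilon>\<^sup>2 * \<tau> m)"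
proof -
  define hit where "hit n \<omega> \<longleftrightarrow> (\<exists>j\<in>{m..n}. \<epsilon> \<le> \<bar>\<Theta> j \<omega> - \<Theta> m \<omega>\<bar>)" for n \<omega>
  \<comment> \<open>Freezing the supermartingale at \<open>\<epsilon>\<^sup>2\<close> once the deviation occurs keeps it one.\<close>
  define W where "W n \<omega> = (if hit n \<omega> then \<epsilon>\<^sup>2 else (\<Theta> n \<omega> - \<Theta> m \<omega>)\<^sup>2 + 1 / \<tau> n)" for n \<omega>
  have hit_meas: "Measurable.pred (history M B n) (hit n)" for n
  proof -
    have "Measurable.pred (history M B n) (\<lambda>\<omega>. \<epsilon> \<le> \<bar>\<Theta> j \<omega> - \<Theta> m \<omega>\<bar>)" if "j \<in> {m..n}" for j
    proof -
      have [measurable]: "\<Theta> j \<in> borel_measurable (history M B n)" "\<Theta> m \<in> borel_measurable (history M B n)"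
        using that by (auto intro: proportion_measurable_history)
      show ?thesis by measurable
    qed
    then show ?thesis unfolding hit_def[abs_def]
      by (intro pred_intros_finite) auto
  qed
  have hitM [measurable]: "Measurable.pred M (hit n)" for n
    by (rule measurable_from_history[OF hit_meas])
  have WM [measurable]: "W n \<in> borel_measurable M" for n
    unfolding W_def[abs_def] by measurable
  have sq: "(a - b)\<^sup>2 \<le> 1" if "0 \<le> a" "a \<le> 1" "0 \<le> b" "b \<le> 1" for a b :: real
    using that by (simp add: abs_square_le_1 abs_le_iff)
  have inv: "1 / real (\<tau> n) \<le> 1" for n
    using total_balls_pos[of n] by simp
  have W_int: "integrable M (W n)" for n
  proof (rule integrable_bounded_AE[where c = "\<epsilon>\<^sup>2 + 2"])
    show "AE \<omega> in M. 0 \<le> W n \<omega> \<and> W n \<omega> \<le> \<epsilon>\<^sup>2 + 2"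
      using AE_proportion_range[of n] AE_proportion_range[of m]
    proof eventually_elim
      case (elim \<omega>)
      then have "(\<Theta> n \<omega> - \<Theta> m \<omega>)\<^sup>2 \<le> 1" by (intro sq) auto
      moreover have "0 \<le> \<epsilon>\<^sup>2" by simp
      ultimately have "(\<Theta> n \<omega> - \<Theta> m \<omega>)\<^sup>2 + 1 / \<tau> n \<le> \<epsilon>\<^sup>2 + 2"
        using inv[of n] by linarith
      then show ?case unfolding W_def by (auto intro: add_nonneg_nonneg)
    qed
  qed simp
  have W_step: "(\<integral>\<omega>. W (Suc n) \<omega> \<partial>M) \<le> (\<integral>\<omega>. W n \<omega> \<partial>M)" if mn: "m \<le> n" for n
  proof -
    let ?s = "\<sigma> (Suc n)" and ?t' = "real (\<tau> (Suc n))"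
    \<comment> \<open>The value after a batch of size \<open>k\<close>, with the freezing still
      decided at time \<open>n\<close>, so that \<open>g k\<close> is measurable with respect to the
      history.\<close>
    define g where "g k \<omega> = (if hit n \<omega> then \<epsilon>\<^sup>2
      else ((T n \<omega> / ?t' - \<Theta> m \<omega>) + 1 / ?t' * real k)\<^sup>2 + 1 / ?t')" for k \<omega>
    have t: "0 < real (\<tau> n)" "0 < ?t'" "?t' = real (\<tau> n) + real ?s"
      using total_balls_pos[of n] total_balls_pos[of "Suc n"] by (auto simp: total_balls_Suc)
    have g_meas: "g k \<in> borel_measurable (history M B n)" for k
    proof -
      have [measurable]: "T n \<in> measurable (history M B n) (count_space UNIV)"
        "\<Theta> m \<in> borel_measurable (history M B n)"
        using mn by (auto intro: proportion_measurable_history first_bin_measurable_history)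
      note hit_meas[measurable]
      show ?thesis unfolding g_def[abs_def] by measurable
    qed
    have g_int: "integrable M (g k)" for k
    proof (rule integrable_bounded_AE[where c = "\<epsilon>\<^sup>2 + ((2 + real k)\<^sup>2 + 1)"])
      show "AE \<omega> in M. 0 \<le> g k \<omega> \<and> g k \<omega> \<le> \<epsilon>\<^sup>2 + ((2 + real k)\<^sup>2 + 1)"
        using AE_first_bin_le[of n] AE_proportion_range[of m]
      proof eventually_elim
        case (elim \<omega>)
        have "0 \<le> T n \<omega> / ?t'" "T n \<omega> / ?t' \<le> 1" "0 \<le> 1 / ?t' * real k"
          using elim(1) t by auto
        moreover have "1 / ?t' * real k \<le> 1 * real k"
          using inv[of "Suc n"] by (rule mult_right_mono) simp
        ultimately have "\<bar>(T n \<omega> / ?t' - \<Theta> m \<omega>) + 1 / ?t' * real k\<bar> \<le> \<bar>2 + real k\<bar>"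
          using elim(2) by linarith
        then have "((T n \<omega> / ?t' - \<Theta> m \<omega>) + 1 / ?t' * real k)\<^sup>2 \<le> (2 + real k)\<^sup>2"
          by (simp only: abs_le_square_iff)
        then have "((T n \<omega> / ?t' - \<Theta> m \<omega>) + 1 / ?t' * real k)\<^sup>2 + 1 / ?t' \<le> (2 + real k)\<^sup>2 + 1"
          using inv[of "Suc n"] by (rule add_mono)
        then show ?case unfolding g_def by (auto intro: add_nonneg_nonneg add_increasing)
      qed
    qed (rule measurable_from_history[OF g_meas])
    show ?thesis
    proof (rule expectation_step_le[OF g_meas g_int W_int W_int])
      have "W (Suc n) \<omega> \<le> g (B (Suc n) \<omega>) \<omega>" for \<omega>
      proof -
        have eq: "(T n \<omega> / ?t' - \<Theta> m \<omega>) + 1 / ?t' * real (B (Suc n) \<omega>) = \<Theta> (Suc n) \<omega> - \<Theta> m \<omega>"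
          by (simp add: proportion_def first_bin_Suc add_divide_distrib)
        have "hit n \<omega> \<Longrightarrow> hit (Suc n) \<omega>" unfolding hit_def by force
        \<comment> \<open>If the deviation first occurs at time \<open>Suc n\<close>, then
          \<open>W\<close> drops to \<open>\<epsilon>\<^sup>2\<close>, which the true square already
          exceeds or equals.\<close>
        moreover have "\<epsilon>\<^sup>2 \<le> (\<Theta> (Suc n) \<omega> - \<Theta> m \<omega>)\<^sup>2" if "hit (Suc n) \<omega>" "\<not> hit n \<omega>"
        proof -
          have "\<epsilon> \<le> \<bar>\<Theta> (Suc n) \<omega> - \<Theta> m \<omega>\<bar>"
            using that unfolding hit_def by (metis atLeastAtMost_iff le_Suc_eq)
          then show ?thesis using \<epsilon> by (simp add: abs_le_square_iff[symmetric])
        qed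
        moreover have "0 \<le> 1 / ?t'" by simp
        ultimately show ?thesis unfolding W_def g_def eq by (auto intro: add_increasing2)
      qed
      then show "AE \<omega> in M. W (Suc n) \<omega> \<le> g (B (Suc n) \<omega>) \<omega>" by simp
      show "AE \<omega> in M. (\<Sum>k\<le>?s. g k \<omega> * Bernstein ?s k (\<Theta> n \<omega>)) \<le> W n \<omega>"
        using AE_proportion_range[of n]
      proof eventually_elim
        case (elim \<omega>)
        let ?p = "\<Theta> n \<omega>"
        show ?case
        proof (cases "hit n \<omega>")
          case True
          then show ?thesis by (simp add: g_def W_def sum_distrib_left[symmetric])
        next
          case False
          \<comment> \<open>The martingale property: the conditional mean of the next proportion is
            the present one.\<close>
          have "real (T n \<omega>) = real (\<tau> n) * ?p" using t by (simp add: proportion_def)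
          then have "real (T n \<omega>) + real ?s * ?p = ?t' * ?p"
            unfolding t(3) by (simp add: distrib_right)
          then have "(real (T n \<omega>) + real ?s * ?p) / ?t' = ?p"
            using t(2) by simp
          then have mean: "(T n \<omega> / ?t' - \<Theta> m \<omega>) + 1 / ?t' * (real ?s * ?p) = ?p - \<Theta> m \<omega>"
            by (simp add: add_divide_distrib)
          have "(\<Sum>k\<le>?s. g k \<omega> * Bernstein ?s k ?p)
              = (?p - \<Theta> m \<omega>)\<^sup>2 + (1 / ?t')\<^sup>2 * (real ?s * ?p * (1 - ?p)) + 1 / ?t'"
            using False
            by (simp only: g_def if_False distrib_right sum.distrib sum_Bernstein_square mean
                sum_distrib_left[symmetric] sum_Bernstein mult_1_right)
          \<comment> \<open>The conditional variance is paid for by the decrease of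
            \<open>1 / \<tau>\<close>: replacing one factor \<open>?t'\<close> in the denominator by
            the smaller \<open>\<tau> n\<close> makes the bound telescope.\<close>
          also have "(1 / ?t')\<^sup>2 * (real ?s * ?p * (1 - ?p)) \<le> 1 / real (\<tau> n) - 1 / ?t'"
          proof -
            have "?p * (1 - ?p) \<le> 1 * 1" using elim by (intro mult_mono) auto
            then have "real ?s * (?p * (1 - ?p)) \<le> real ?s * 1" by (intro mult_left_mono) auto
            then have "(1 / ?t')\<^sup>2 * (real ?s * ?p * (1 - ?p)) \<le> (1 / ?t')\<^sup>2 * real ?s"
              by (intro mult_left_mono) (auto simp: mult.assoc)
            also have "\<dots> = 1 / ?t' * (real ?s / ?t')" by (simp add: power2_eq_square)
            also have "\<dots> \<le> 1 / ?t' * (real ?s / real (\<tau> n))"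
              using t by (intro mult_left_mono divide_left_mono) auto
            also have "\<dots> = 1 / real (\<tau> n) - 1 / ?t'"
              using t by (simp add: field_simps)
            finally show ?thesis .
          qed
          finally show ?thesis using False by (simp add: W_def)
        qed
      qed
    qed
  qed
  have "(\<integral>\<omega>. W n \<omega> \<partial>M) \<le> 1 / \<tau> m"
    using \<open>m \<le> n\<close>
  proof (induction n rule: dec_induct)
    case base
    \<comment> \<open>At time \<open>m\<close> the deviation is 0, so positivity of
      \<open>\<epsilon>\<close> rules out an immediate hit.\<close>
    have "W m = (\<lambda>\<omega>. 1 / \<tau> m)" using \<epsilon> by (auto simp: W_def hit_def)
    then show ?case by (simp add: prob_space)
  next
    case (step n)
    then show ?case using W_step[of n] by simp
  qed
  moreover have "\<epsilon>\<^sup>2 * prob {\<omega> \<in> space M. hit n \<omega>} \<le> (\<integral>\<omega>. W n \<omega> \<partial>M)"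
  proof -
    have "\<epsilon>\<^sup>2 * prob {\<omega> \<in> space M. hit n \<omega>} = (\<integral>\<omega>. \<epsilon>\<^sup>2 * indicator {\<omega> \<in> space M. hit n \<omega>} \<omega> \<partial>M)"
      by simp
    also have "\<dots> \<le> (\<integral>\<omega>. W n \<omega> \<partial>M)"
    proof (rule integral_mono[OF _ W_int])
      show "integrable M (\<lambda>\<omega>. \<epsilon>\<^sup>2 * indicator {\<omega> \<in> space M. hit n \<omega>} \<omega>)"
        by (intro integrable_mult_right integrable_real_indicator) (auto simp: less_top[symmetric])
    qed (auto simp: W_def indicator_def)
    finally show ?thesis .
  qed
  ultimately have "\<epsilon>\<^sup>2 * prob {\<omega> \<in> space M. hit n \<omega>} \<le> 1 / \<tau> m" by simp
  then show ?thesis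
    using \<epsilon> total_balls_pos[of m] unfolding hit_def by (simp add: field_simps)
qed

lemma prob_later_deviation_le:
  assumes \<epsilon>: "0 < \<epsilon>"
  shows "prob {\<omega> \<in> space M. \<exists>j\<ge>m. \<epsilon> \<le> \<bar>\<Theta> j \<omega> - \<Theta> m \<omega>\<bar>} \<le> 1 / (\<epsilon>\<^sup>2 * \<tau> m)"
proof -
  let ?A = "\<lambda>n. {\<omega> \<in> space M. \<exists>j\<in>{m..n}. \<epsilon> \<le> \<bar>\<Theta> j \<omega> - \<Theta> m \<omega>\<bar>}"
  have "(\<lambda>n. prob (?A n)) \<longlonglongrightarrow> prob (\<Union>n. ?A n)"
    by (rule finite_Lim_measure_incseq) (auto simp: incseq_def intro: order_trans)
  then have "prob (\<Union>n. ?A n) \<le> 1 / (\<epsilon>\<^sup>2 * \<tau> m)"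
    by (rule LIMSEQ_le_const2) (use prob_deviation_le[OF \<epsilon>, of m] in blast)
  also have "(\<Union>n. ?A n) = {\<omega> \<in> space M. \<exists>j\<ge>m. \<epsilon> \<le> \<bar>\<Theta> j \<omega> - \<Theta> m \<omega>\<bar>}"
    by auto (meson atLeastAtMost_iff order_refl)
  finally show ?thesis .
qed

text \<open>Failure means a deviation of at least \<open>\<epsilon>\<close> after every starting
  time \<open>m\<close>. The intersection of these events is bounded by each of their probabilities,
  and these tend to 0 because \<open>\<tau> m\<close> tends to infinity.\<close>

lemma AE_proportion_small_deviation:
  assumes \<epsilon>: "0 < \<epsilon>"
  shows "AE \<omega> in M. \<exists>m. \<forall>j\<ge>m. \<bar>\<Theta> j \<omega> - \<Theta> m \<omega>\<bar> < \<epsilon>"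
proof -
  let ?D = "\<lambda>m. {\<omega> \<in> space M. \<exists>j\<ge>m. \<epsilon> \<le> \<bar>\<Theta> j \<omega> - \<Theta> m \<omega>\<bar>}"
  have [measurable]: "?D m \<in> sets M" for m by measurable
  have meas: "(\<Inter>m. ?D m) \<in> sets M" by measurable
  have "prob (\<Inter>m. ?D m) \<le> 1 / (\<epsilon>\<^sup>2 * \<tau> m)" for m
    using finite_measure_mono[of "\<Inter>m. ?D m" "?D m"] prob_later_deviation_le[OF \<epsilon>, of m] by force
  moreover have "(\<lambda>m. 1 / (\<epsilon>\<^sup>2 * \<tau> m)) \<longlonglongrightarrow> 0"
    using \<epsilon> by (intro tendsto_divide_0[OF tendsto_const] filterlim_at_top_imp_at_infinity
        filterlim_tendsto_pos_mult_at_top[OF tendsto_const] filterlim_total_balls) auto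
  ultimately have "prob (\<Inter>m. ?D m) \<le> 0"
    by (intro LIMSEQ_le_const) auto
  then have "prob (\<Inter>m. ?D m) = 0" by (simp add: measure_le_0_iff)
  then have "AE \<omega> in M. \<omega> \<notin> (\<Inter>m. ?D m)" using meas by (simp only: prob_eq_0)
  with AE_space show ?thesis
    by eventually_elim (simp, meson not_le)
qed

lemma AE_convergent_proportion: "AE \<omega> in M. convergent (\<lambda>n. \<Theta> n \<omega>)"
proof -
  \<comment> \<open>Countably many tolerances allow a single null set to serve all of them.\<close>
  have "AE \<omega> in M. \<forall>p. \<exists>m. \<forall>j\<ge>m. \<bar>\<Theta> j \<omega> - \<Theta> m \<omega>\<bar> < inverse (real (Suc p))"
    unfolding AE_all_countable by (intro allI AE_proportion_small_deviation) simp
  then show ?thesis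
  proof eventually_elim
    case (elim \<omega>)
    have "\<exists>m. \<forall>j\<ge>m. dist (\<Theta> j \<omega>) (\<Theta> m \<omega>) < e" if "0 < e" for e
    proof -
      obtain p where "inverse (real (Suc p)) < e" using reals_Archimedean[OF \<open>0 < e\<close>] by auto
      then show ?thesis using elim unfolding dist_real_def by (meson less_trans)
    qed
    \<comment> \<open>Closeness to one reference term \<open>\<Theta> m\<close> for each tolerance
      characterises Cauchy sequences.\<close>
    then have "Cauchy (\<lambda>n. \<Theta> n \<omega>)" by (simp add: Cauchy_altdef2)
    then show ?case by (simp add: Cauchy_convergent_iff)
  qed
qed

end

theorem theorem1p1:
  fixes M :: "'a measure"
    and \<sigma> :: "nat \<Rightarrow> nat"
    and \<tau>0 T0 :: nat
    and B :: "nat \<Rightarrow> 'a \<Rightarrow> nat"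
  assumes "balls_and_bins M 1 \<sigma> \<tau>0 T0 B"
  shows "(\<exists>\<Theta> \<in> borel_measurable M.
            AE \<omega> in M. (\<lambda>n. proportion \<tau>0 \<sigma> T0 B n \<omega>) \<longlonglongrightarrow> \<Theta> \<omega>)
       \<and> dominance M \<sigma> \<tau>0 T0 B \<in> sets M
       \<and> measure M (dominance M \<sigma> \<tau>0 T0 B) = 0"
proof -
  interpret linear_balls_and_bins M \<sigma> \<tau>0 T0 B
    using assms by (simp add: linear_balls_and_bins_def)
  \<comment> \<open>\<open>lim\<close> is total, so it gives a measurable limit variable on the
    whole space; its value on the null set of divergence is immaterial.\<close>
  have "(\<lambda>\<omega>. lim (\<lambda>n. \<Theta> n \<omega>)) \<in> borel_measurable M" by measurable
  moreover have "AE \<omega> in M. (\<lambda>n. \<Theta> n \<omega>) \<longlonglongrightarrow> lim (\<lambda>n. \<Theta> n \<omega>)"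
    using AE_convergent_proportion by eventually_elim (simp add: convergent_LIMSEQ_iff)
  moreover have "prob (dominance M \<sigma> \<tau>0 T0 B) = 0"
    using AE_not_dominance dominance_measurable by (simp add: prob_eq_0)
  ultimately show ?thesis using dominance_measurable by (intro conjI bexI)
qed

end
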